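(* Let $S=\{n_1,n_2,n_3\}$ be a three-element set of integers with $n_j\neq 0$ for $j=1,2,3$. If $S$ is not of the form $\{-n,n,2n\}$ for any integer $n$, then the angular Kronecker constant of $S$ satisfies $\alpha(S)\leq 5/16$.
   Context: For a finite set $S$ of integers, the Kronecker constant $\kappa(S)$ is the infimum of all $\varepsilon>0$ such that for every function $f:S\to\mathbb T=\{z\in\mathbb C:|z|=1\}$ there exists $x\in\mathbb R$ with $|e^{2\pi i n x}-f(n)|<\varepsilon$ for all $n\in S$. The angular Kronecker constant $\alpha(S)\in[0,1/2]$ is defined by $\kappa(S)=|e^{2\pi i\alpha(S)}-1|$. Equivalently, $\alpha(S)$ is the infimum of all $E\ge 0$ such that for every choice of real numbers $(\theta_n)_{n\in S}$ there is $x\in\mathbb R$ such that the distance from $nx-\theta_n$ to the nearest integer is at most $E$ for every $n\in S$. *)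

theory Defs
  imports Complex_Main
begin

definition kronecker_constant :: "int set \<Rightarrow> real" where
  "kronecker_constant S = Inf {\<epsilon>. \<epsilon> > 0 \<and>
     (\<forall>f :: int \<Rightarrow> complex. (\<forall>n\<in>S. cmod (f n) = 1) \<longrightarrow>
        (\<exists>x::real. \<forall>n\<in>S. cmod (exp (2 * of_real pi * \<i> * of_int n * of_real x) - f n) < \<epsilon>))}"

definition angular_kronecker_constant :: "int set \<Rightarrow> real" where
  "angular_kronecker_constant S = (THE \<alpha>. 0 \<le> \<alpha> \<and> \<alpha> \<le> 1/2 \<and>
     kronecker_constant S = cmod (exp (2 * of_real pi * \<i> * of_real \<alpha>) - 1))"

lemma kronecker_constant_bounds: "0 \<le> kronecker_constant S" "kronecker_constant S \<le> 2"
proof -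
  let ?P = "\<lambda>\<epsilon>. \<epsilon> > 0 \<and>
     (\<forall>f :: int \<Rightarrow> complex. (\<forall>n\<in>S. cmod (f n) = 1) \<longrightarrow>
        (\<exists>x::real. \<forall>n\<in>S. cmod (exp (2 * of_real pi * \<i> * of_int n * of_real x) - f n) < \<epsilon>))"
  have large: "?P \<epsilon>" if "2 < \<epsilon>" for \<epsilon> :: real
  proof (intro conjI allI impI exI ballI)
    show "\<epsilon> > 0" using that by simp
  next
    fix f :: "int \<Rightarrow> complex" and n
    assume f: "\<forall>n\<in>S. cmod (f n) = 1" and n: "n \<in> S"
    have "cmod (exp (2 * of_real pi * \<i> * of_int n * of_real 0) - f n) \<le> 1 + cmod (f n)"
      using norm_triangle_ineq4[of 1 "f n"] by simp
    then show "cmod (exp (2 * of_real pi * \<i> * of_int n * of_real 0) - f n) < \<epsilon>"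
      using f n that by simp
  qed
  have bdd: "bdd_below {\<epsilon>. ?P \<epsilon>}" by (intro bdd_belowI[of _ 0]) auto
  have "3 \<in> {\<epsilon>. ?P \<epsilon>}" using large[of 3] by (intro CollectI) simp
  then have "{\<epsilon>. ?P \<epsilon>} \<noteq> {}" by blast
  then show "0 \<le> kronecker_constant S"
    unfolding kronecker_constant_def by (intro cInf_greatest) auto
  show "kronecker_constant S \<le> 2"
  proof (rule dense_ge)
    fix \<epsilon> :: real assume "2 < \<epsilon>"
    then show "kronecker_constant S \<le> \<epsilon>"
      unfolding kronecker_constant_def by (intro cInf_lower bdd) (simp add: large)
  qed
qed

lemma cmod_exp_minus_one:
  assumes "0 \<le> \<alpha>" "\<alpha> \<le> 1/2"
  shows "cmod (exp (2 * of_real pi * \<i> * of_real \<alpha>) - 1) = 2 * sin (pi * \<alpha>)"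
proof -
  have "exp (2 * of_real pi * \<i> * of_real \<alpha>) = cis (2 * (pi * \<alpha>))"
    by (simp add: cis_conv_exp mult_ac)
  also have "(cmod (\<dots> - 1))\<^sup>2 = (cos (2 * (pi * \<alpha>)) - 1)\<^sup>2 + (sin (2 * (pi * \<alpha>)))\<^sup>2"
    by (simp add: cmod_power2)
  also have "\<dots> = 2 - 2 * cos (2 * (pi * \<alpha>))"
    using sin_cos_squared_add[of "2 * (pi * \<alpha>)"] by (simp add: power2_diff)
  also have "\<dots> = (2 * sin (pi * \<alpha>))\<^sup>2"
    by (simp add: cos_double_sin power_mult_distrib)
  finally have "(cmod (exp (2 * of_real pi * \<i> * of_real \<alpha>) - 1))\<^sup>2 = (2 * sin (pi * \<alpha>))\<^sup>2"
    by (simp add: cis_conv_exp mult_ac)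
  moreover have "0 \<le> sin (pi * \<alpha>)"
    using assms by (intro sin_ge_zero) (auto simp: mult_left_le)
  ultimately show ?thesis by - (rule power2_eq_imp_eq, simp_all)
qed

lemma angular_kronecker_constant_ex1:
  "\<exists>!\<alpha>. 0 \<le> \<alpha> \<and> \<alpha> \<le> 1/2 \<and>
     kronecker_constant S = cmod (exp (2 * of_real pi * \<i> * of_real \<alpha>) - 1)"
proof (rule ex_ex1I)
  let ?k = "kronecker_constant S"
  let ?a = "arcsin (?k / 2) / pi"
  have b: "0 \<le> ?k / 2" "?k / 2 \<le> 1" using kronecker_constant_bounds[of S] by auto
  have "0 \<le> arcsin (?k / 2)" using arcsin_le_arcsin[of 0 "?k / 2"] b by simp
  moreover have "arcsin (?k / 2) \<le> pi / 2" using arcsin_ubound[of "?k / 2"] b by simp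
  ultimately have a: "0 \<le> ?a" "?a \<le> 1/2" by (auto simp: field_simps)
  have "sin (pi * ?a) = ?k / 2" using b by simp
  then show "\<exists>\<alpha>. 0 \<le> \<alpha> \<and> \<alpha> \<le> 1/2 \<and>
      ?k = cmod (exp (2 * of_real pi * \<i> * of_real \<alpha>) - 1)"
    using a cmod_exp_minus_one[OF a] by (intro exI[of _ ?a]) simp
next
  fix \<alpha> \<beta> :: real
  assume A: "0 \<le> \<alpha> \<and> \<alpha> \<le> 1/2 \<and>
      kronecker_constant S = cmod (exp (2 * of_real pi * \<i> * of_real \<alpha>) - 1)"
    and B: "0 \<le> \<beta> \<and> \<beta> \<le> 1/2 \<and>
      kronecker_constant S = cmod (exp (2 * of_real pi * \<i> * of_real \<beta>) - 1)"
  then have s: "sin (pi * \<alpha>) = sin (pi * \<beta>)"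
    using cmod_exp_minus_one[of \<alpha>] cmod_exp_minus_one[of \<beta>] by linarith
  have *: "- (pi / 2) \<le> pi * t \<and> pi * t \<le> pi / 2" if "0 \<le> t" "t \<le> 1/2" for t
  proof -
    have "0 \<le> pi * t" using that by simp
    moreover have "pi * t \<le> pi * (1/2)" using that by (intro mult_left_mono) auto
    ultimately show ?thesis using pi_gt_zero by linarith
  qed
  have "pi * \<alpha> = pi * \<beta>"
    by (rule sin_inj_pi) (use *[of \<alpha>] *[of \<beta>] A B s in blast)+
  then show "\<alpha> = \<beta>" by simp
qed

end

theory Submission
  imports Defs
begin

text \<open>
  Only the absolute values \<open>a \<le> b \<le> c\<close> of the elements matter, and a common factor may be removed.
  If two of them have greatest common divisor \<open>d \<ge> 2\<close>, then a point \<open>x\<close> serving these two within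
  \<open>1/4\<close> may be translated by multiples of \<open>1/d\<close> to serve the third one within \<open>1/(2 d)\<close>.
  If they are pairwise coprime, Bezout's identity lets one move the targets for \<open>a\<close> and \<open>b\<close> by
  integers so that the points serving both within \<open>5/16\<close> form an interval so long that its image
  under \<open>x \<mapsto> c x\<close> has length at least \<open>1 - 2 * 5/16\<close>, and hence comes close to the third target.
  This works as soon as \<open>c * (5 * (a + b) - 8) \<ge> 6 * a * b\<close>, which only fails for
  \<open>(1, 1, 1)\<close> and \<open>(1, 1, 2)\<close>.
\<close>

section \<open>Simultaneous approximation modulo 1 and its symmetries\<close>

text \<open>A triple rather than a set: after passing to absolute values two entries may coincide
  while their targets still differ.\<close>

definition approximable :: "real \<Rightarrow> int \<Rightarrow> int \<Rightarrow> int \<Rightarrow> bool" where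
  "approximable E a b c \<longleftrightarrow> (\<forall>s t u. \<exists>x. \<exists>i j k :: int.
     \<bar>of_int a * x - s - of_int i\<bar> \<le> E \<and>
     \<bar>of_int b * x - t - of_int j\<bar> \<le> E \<and>
     \<bar>of_int c * x - u - of_int k\<bar> \<le> E)"

lemma approximable_rotate: "approximable E a b c \<Longrightarrow> approximable E b c a"
  unfolding approximable_def by blast

lemma approximable_uminus:
  assumes "approximable E a b c"
  shows "approximable E (- a) b c"
  unfolding approximable_def
proof (intro allI)
  fix s t u
  obtain x and i j k :: int where "\<bar>of_int a * x - (- s) - of_int i\<bar> \<le> E"
    "\<bar>of_int b * x - t - of_int j\<bar> \<le> E" "\<bar>of_int c * x - u - of_int k\<bar> \<le> E"
    using assms unfolding approximable_def by blast
  then show "\<exists>x. \<exists>i j k :: int. \<bar>of_int (- a) * x - s - of_int i\<bar> \<le> E \<and>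
     \<bar>of_int b * x - t - of_int j\<bar> \<le> E \<and> \<bar>of_int c * x - u - of_int k\<bar> \<le> E"
    by (intro exI[of _ x] exI[of _ "- i"] exI[of _ j] exI[of _ k]) auto
qed

lemma approximable_abs:
  assumes "approximable E \<bar>a\<bar> \<bar>b\<bar> \<bar>c\<bar>"
  shows "approximable E a b c"
proof -
  have step: "approximable E q r p" if "approximable E \<bar>p\<bar> q r" for p q r
    using that approximable_uminus[of E "\<bar>p\<bar>" q r]
    by (cases "p \<ge> 0") (auto intro: approximable_rotate)
  show ?thesis
    \<comment> \<open>Each use of \<open>step\<close> strips one absolute value and rotates; three
      rotations restore the original order.\<close>
    by (rule step, rule step, rule step, rule assms)
qed

lemma approximable_scale:
  assumes "approximable E a b c" "d \<noteq> 0"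
  shows "approximable E (d * a) (d * b) (d * c)"
  unfolding approximable_def
proof (intro allI)
  fix s t u
  obtain x and i j k :: int where "\<bar>of_int a * x - s - of_int i\<bar> \<le> E"
    "\<bar>of_int b * x - t - of_int j\<bar> \<le> E" "\<bar>of_int c * x - u - of_int k\<bar> \<le> E"
    using assms unfolding approximable_def by blast
  with \<open>d \<noteq> 0\<close> show "\<exists>x. \<exists>i j k :: int. \<bar>of_int (d * a) * x - s - of_int i\<bar> \<le> E \<and>
     \<bar>of_int (d * b) * x - t - of_int j\<bar> \<le> E \<and> \<bar>of_int (d * c) * x - u - of_int k\<bar> \<le> E"
    by (intro exI[of _ "x / of_int d"] exI[of _ i] exI[of _ j] exI[of _ k]) auto
qed

section \<open>Good intervals for coprime pairs\<close>

lemma bezout_int_mult: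
  fixes a b m :: int
  assumes "coprime a b"
  obtains i j where "a * i + b * j = m"
proof -
  obtain u v where "u * a + v * b = 1"
    using bezout_int[of a b] assms by auto
  then have "a * (m * u) + b * (m * v) = m * 1"
    by (metis distrib_left mult.assoc mult.commute)
  then show ?thesis by (intro that) simp
qed

text \<open>For fixed \<open>i\<close> and \<open>j\<close> the good points of each condition form
  an interval, centred at \<open>(s + i) / a\<close> and \<open>(t + j) / b\<close>. Since
  \<open>b * i - a * j\<close> takes every integer value, the centres can be brought within
  \<open>1 / (2 * a * b)\<close> of each other. The bound may be negative, in which case the
  interval may be empty.\<close>

lemma coprime_pair_interval:
  fixes a b :: int and E s t :: real
  assumes "coprime a b" "a > 0" "b > 0"
  obtains L U :: real and i j :: int where
    "\<And>x. L \<le> x \<Longrightarrow> x \<le> U \<Longrightarrow> \<bar>of_int a * x - s - of_int i\<bar> \<le> E \<and> \<bar>of_int b * x - t - of_int j\<bar> \<le> E"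
    "U - L \<ge> min (2 * E / a) (min (2 * E / b) ((E * (a + b) - 1 / 2) / (a * b)))"
proof -
  define m where "m = round (a * t - b * s)"
  obtain i j' where ij': "b * i + a * j' = m"
    using bezout_int_mult[of b a m] assms(1) by (auto simp: coprime_commute)
  define j where "j = - j'"
  define S T where "S = s + of_int i" and "T = t + of_int j"
  have "b * S - a * T = of_int m - (a * t - b * s)"
    unfolding S_def T_def j_def ij'[symmetric] by (simp add: algebra_simps)
  then have kap: "\<bar>b * S - a * T\<bar> \<le> 1 / 2"
    using of_int_round_abs_le[of "a * t - b * s"] unfolding m_def by simp
  define L U where "L = max ((S - E) / a) ((T - E) / b)" and "U = min ((S + E) / a) ((T + E) / b)"
  have "\<bar>of_int a * x - s - of_int i\<bar> \<le> E \<and> \<bar>of_int b * x - t - of_int j\<bar> \<le> E"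
    if "L \<le> x" "x \<le> U" for x
    using that assms unfolding L_def U_def S_def T_def by (auto simp: field_simps abs_le_iff)
  moreover have "U - L \<ge> min (2 * E / a) (min (2 * E / b) ((E * (a + b) - 1 / 2) / (a * b)))" (is "_ \<ge> ?m")
  proof -
    \<comment> \<open>\<open>U - L\<close> is the least of four differences of endpoints: two are
      the full lengths of the intervals, the two mixed ones measure their overlap.\<close>
    have m: "?m \<le> 2 * E / a" "?m \<le> 2 * E / b" "?m \<le> (E * (a + b) - 1 / 2) / (a * b)"
      by simp_all
    have "(S + E) / a - (S - E) / a = 2 * E / a" "(T + E) / b - (T - E) / b = 2 * E / b"
      by (simp_all flip: diff_divide_distrib)
    moreover have "(S + E) / a - (T - E) / b = (E * (a + b) + (b * S - a * T)) / (a * b)"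
      "(T + E) / b - (S - E) / a = (E * (a + b) - (b * S - a * T)) / (a * b)"
      using assms by (simp_all add: field_simps)
    moreover have "(E * (a + b) - 1 / 2) / (a * b) \<le> (E * (a + b) + (b * S - a * T)) / (a * b)"
      "(E * (a + b) - 1 / 2) / (a * b) \<le> (E * (a + b) - (b * S - a * T)) / (a * b)"
      using kap assms by (auto intro!: divide_right_mono simp del: le_divide_eq_numeral1)
    ultimately show ?thesis using m unfolding L_def U_def by linarith
  qed
  ultimately show ?thesis by (rule that)
qed

lemma approximable_coprime:
  fixes a b c :: int
  assumes "coprime a b" "a > 0" "b > 0" "c > 0"
    and "a \<le> b" "b \<le> c" "6 * (a * b) \<le> c * (5 * (a + b) - 8)"
  shows "approximable (5/16) a b c"
  unfolding approximable_def
proof (intro allI)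
  fix s t u :: real
  obtain L U :: real and i j :: int where
    pair: "\<And>x. L \<le> x \<Longrightarrow> x \<le> U \<Longrightarrow>
      \<bar>of_int a * x - s - of_int i\<bar> \<le> 5/16 \<and> \<bar>of_int b * x - t - of_int j\<bar> \<le> 5/16"
    and UL: "U - L \<ge> min (2 * (5/16) / a) (min (2 * (5/16) / b) ((5/16 * (a + b) - 1 / 2) / (a * b)))"
    using coprime_pair_interval[OF assms(1-3)] by blast
  have c: "real_of_int c > 0" using assms by simp
  have *: "real_of_int 6 * (a * b) \<le> c * (5 * (a + b) - 8)"
    using assms(7) by (metis of_int_le_iff of_int_mult)
  \<comment> \<open>\<open>3/8 = 1 - 2 * (5/16)\<close> is the gap between consecutive windows
    around \<open>u + k\<close>. The comparison with the overlap below is the last hypothesis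
    divided by \<open>16 * a * b * c\<close>.\<close>
  have "3 / 8 / c \<le> 2 * (5/16) / a" "3 / 8 / c \<le> 2 * (5/16) / b"
    using assms by (simp_all add: field_simps)
  moreover have "3 / 8 / c \<le> (5/16 * (a + b) - 1 / 2) / (a * b)"
    using assms * by (simp add: field_simps)
  ultimately have "3 / 8 / c \<le> U - L"
    using UL by linarith
  then have cUL: "c * L + 3 / 8 \<le> c * U"
    using c by (simp add: field_simps)
  \<comment> \<open>The first window around \<open>u + k\<close> that does not end before
    \<open>c * L\<close>; \<open>y\<close> is its first point from \<open>c * L\<close> on, hence at
    most \<open>c * L + 3/8\<close>.\<close>
  define k where "k = \<lceil>c * L - u - 5/16\<rceil>"
  define y where "y = max (c * L) (u + of_int k - 5/16)"
  have k: "c * L - u - 5/16 \<le> of_int k" "of_int k \<le> c * L - u - 5/16 + 1"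
    unfolding k_def by linarith+
  have "c * L \<le> y" "y \<le> c * U" "\<bar>y - u - of_int k\<bar> \<le> 5/16"
    using k cUL unfolding y_def by linarith+
  moreover have "c * (y / c) = y" using c by simp
  ultimately have "L \<le> y / c" "y / c \<le> U" "\<bar>c * (y / c) - u - of_int k\<bar> \<le> 5/16"
    using c by (simp_all add: field_simps)
  then show "\<exists>x. \<exists>i j k :: int. \<bar>of_int a * x - s - of_int i\<bar> \<le> 5/16 \<and>
     \<bar>of_int b * x - t - of_int j\<bar> \<le> 5/16 \<and> \<bar>of_int c * x - u - of_int k\<bar> \<le> 5/16"
    using pair by blast
qed

section \<open>Pairs with a common factor\<close>

lemma approximable_common_factor:
  fixes a b c :: int
  assumes "a > 0" "b > 0" and d: "gcd a b \<noteq> 1" and coprime: "coprime (gcd a b) c"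
  shows "approximable (5/16) a b c"
  unfolding approximable_def
proof (intro allI)
  fix s t u :: real
  define d where "d = gcd a b"
  have d2: "d \<ge> 2"
    using d assms gcd_pos_int[of a b] unfolding d_def by linarith
  obtain a' b' where ab: "a = a' * d" "b = b' * d" and "coprime a' b'"
    using gcd_coprime_exists[of a b] assms(1) unfolding d_def by auto
  have pos: "a' > 0" "b' > 0"
    using ab assms d2 by (auto simp: zero_less_mult_iff)
  obtain L U :: real and i j :: int where
    pair: "\<And>y. L \<le> y \<Longrightarrow> y \<le> U \<Longrightarrow>
      \<bar>of_int a' * y - s - of_int i\<bar> \<le> 1/4 \<and> \<bar>of_int b' * y - t - of_int j\<bar> \<le> 1/4"
    and "U - L \<ge> min (2 * (1/4) / a') (min (2 * (1/4) / b') ((1/4 * (a' + b') - 1 / 2) / (a' * b')))"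
    using coprime_pair_interval[OF \<open>coprime a' b'\<close> pos] by blast
  \<comment> \<open>At tolerance \<open>1/4\<close> the overlap bound is nonnegative because
    \<open>a' + b' >= 2\<close>, so the interval contains at least the point
    \<open>L\<close>.\<close>
  moreover have "0 \<le> 2 * (1/4) / real_of_int a'" "0 \<le> 2 * (1/4) / real_of_int b'"
    "0 \<le> (1/4 * (a' + b') - 1 / 2) / (real_of_int (a' * b'))"
    using pos by simp_all
  ultimately have "L \<le> U" by linarith
  then have y: "\<bar>of_int a' * L - s - of_int i\<bar> \<le> 1/4" "\<bar>of_int b' * L - t - of_int j\<bar> \<le> 1/4"
    using pair by auto
  define m where "m = round (d * u - c * L)"
  obtain p q where pq: "c * p + d * q = m"
    using bezout_int_mult[of c d m] coprime by (auto simp: d_def coprime_commute)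
  \<comment> \<open>The shift by \<open>p / d\<close> changes \<open>a * x\<close> and
    \<open>b * x\<close> by the integers \<open>a' * p\<close> and \<open>b' * p\<close>, while
    \<open>c * p = m - d * q\<close> moves \<open>c * x\<close> to within \<open>1 / (2 * d)\<close>
    of \<open>u - q\<close>.\<close>
  define x where "x = (L + p) / d"
  have "of_int a * x - s - of_int (i + a' * p) = a' * L - s - i"
    "of_int b * x - t - of_int (j + b' * p) = b' * L - t - j"
    using d2 unfolding x_def ab by (simp_all add: field_simps)
  moreover have "of_int c * x - u - of_int (- q) = (of_int m - (d * u - c * L)) / d"
    using d2 unfolding x_def pq[symmetric] by (simp add: field_simps)
  moreover have "\<bar>(of_int m - (d * u - c * L)) / d\<bar> \<le> (1 / 2) / 2"
    unfolding abs_divide using d2 of_int_round_abs_le[of "d * u - c * L"]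
    by (intro frac_le) (auto simp: m_def)
  ultimately have "\<bar>of_int a * x - s - of_int (i + a' * p)\<bar> \<le> 5/16 \<and>
     \<bar>of_int b * x - t - of_int (j + b' * p)\<bar> \<le> 5/16 \<and> \<bar>of_int c * x - u - of_int (- q)\<bar> \<le> 5/16"
    using y by linarith
  then show "\<exists>x. \<exists>i j k :: int. \<bar>of_int a * x - s - of_int i\<bar> \<le> 5/16 \<and>
     \<bar>of_int b * x - t - of_int j\<bar> \<le> 5/16 \<and> \<bar>of_int c * x - u - of_int k\<bar> \<le> 5/16"
    by blast
qed

section \<open>Case distinction on common factors\<close>

lemma approximable_sorted_primitive:
  fixes a b c :: int
  assumes "0 < a" "a \<le> b" "b \<le> c" and gcd: "gcd (gcd a b) c = 1"
    and exc: "a = b \<Longrightarrow> c \<noteq> a \<and> c \<noteq> 2 * a"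
  shows "approximable (5/16) a b c"
proof -
  have gcd': "coprime (gcd a b) c" "coprime (gcd b c) a" "coprime (gcd c a) b"
    using gcd by (simp_all add: coprime_iff_gcd_eq_1 gcd.commute gcd.left_commute gcd.assoc)
  consider "gcd a b \<noteq> 1" | "gcd b c \<noteq> 1" | "gcd c a \<noteq> 1" | "gcd a b = 1" "gcd b c = 1" by metis
  then show ?thesis
  proof cases
    case 1
    then show ?thesis using gcd' assms by (intro approximable_common_factor) auto
  next
    case 2
    then have "approximable (5/16) b c a"
      using gcd' assms by (intro approximable_common_factor) auto
    then show ?thesis by (rule approximable_rotate[OF approximable_rotate])
  next
    case 3
    then have "approximable (5/16) c a b"
      using gcd' assms by (intro approximable_common_factor) auto
    then show ?thesis by (rule approximable_rotate)
  next
    case 4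
    have "6 * (a * b) \<le> c * (5 * (a + b) - 8)"
    proof (cases "a = b")
      case True
      then have "a = 1" "b = 1" using 4 assms by auto
      moreover from this have "c \<ge> 3" using exc assms by auto
      ultimately show ?thesis by simp
    next
      case False
      then have ab: "a + 1 \<le> b" using assms by simp
      have "b \<noteq> c" using 4 assms ab by auto
      then have "(b + 1) * (5 * (a + b) - 8) \<le> c * (5 * (a + b) - 8)"
        using assms ab by (intro mult_right_mono) auto
      \<comment> \<open>With \<open>b + 1\<close> in place of \<open>c\<close> the claim reads
        \<open>5*b*b - a*b - 3*b + 5*a >= 8\<close>; these two bounds on the products make it
        linear.\<close>
      moreover have "(a + 1) * b \<le> b * b" "2 * b \<le> b * b"
        using assms ab by (auto intro!: mult_right_mono)
      ultimately show ?thesis using assms(1) ab by (simp only: algebra_simps)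
    qed
    then show ?thesis using 4 assms by (intro approximable_coprime) auto
  qed
qed

lemma approximable_sorted:
  fixes a b c :: int
  assumes "0 < a" "a \<le> b" "b \<le> c" and exc: "a = b \<Longrightarrow> c \<noteq> a \<and> c \<noteq> 2 * a"
  shows "approximable (5/16) a b c"
proof -
  define g where "g = gcd (gcd a b) c"
  have g: "g > 0" using assms(1) unfolding g_def by simp
  have "g dvd a" "g dvd b" "g dvd c"
    unfolding g_def by (meson dvd_trans gcd_dvd1 gcd_dvd2)+
  then obtain a' b' c' where abc: "a = g * a'" "b = g * b'" "c = g * c'"
    by (elim dvdE) blast
  have "g = gcd (gcd (g * a') (g * b')) (g * c')"
    using abc g_def by metis
  also have "\<dots> = g * gcd (gcd a' b') c'"
    using g by (simp flip: gcd_mult_distrib_int)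
  finally have "g * gcd (gcd a' b') c' = g * 1" by simp
  then have "gcd (gcd a' b') c' = 1" using g by simp
  then have "approximable (5/16) a' b' c'"
    using assms g unfolding abc
    by (intro approximable_sorted_primitive) (auto simp: zero_less_mult_iff)
  then show ?thesis
    unfolding abc using g by (intro approximable_scale) auto
qed

section \<open>From distances modulo 1 to chords of the unit circle\<close>

lemma cmod_cis_minus_one: "cmod (cis (2 * y) - 1) = 2 * \<bar>sin y\<bar>"
proof (rule power2_eq_imp_eq)
  have "(cmod (cis (2 * y) - 1))\<^sup>2 = (cos (2 * y) - 1)\<^sup>2 + (sin (2 * y))\<^sup>2"
    by (simp add: cmod_power2)
  also have "\<dots> = 2 - 2 * cos (2 * y)"
    using sin_cos_squared_add[of "2 * y"] by (simp add: power2_diff)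
  also have "\<dots> = (2 * \<bar>sin y\<bar>)\<^sup>2"
    by (simp add: cos_double_sin power_mult_distrib)
  finally show "(cmod (cis (2 * y) - 1))\<^sup>2 = (2 * \<bar>sin y\<bar>)\<^sup>2" .
qed simp_all

lemma abs_sin_le:
  assumes "\<bar>y\<bar> \<le> z" "z \<le> pi / 2"
  shows "\<bar>sin y\<bar> \<le> sin z"
proof -
  have "sin y \<le> sin z" "sin (- z) \<le> sin y"
    by (rule sin_monotone_2pi_le; use assms in linarith)+
  then show ?thesis by simp
qed

text \<open>Rotating by \<open>cis (2 * pi * t)\<close> preserves the modulus and \<open>k\<close>
  vanishes by periodicity, which leaves the chord of an angle of at most
  \<open>2 * pi * E\<close>.\<close>

lemma cmod_exp_diff_le:
  assumes "\<bar>of_int n * x - t - of_int k\<bar> \<le> E" "E \<le> 1/2"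
  shows "cmod (exp (2 * of_real pi * \<i> * of_int n * of_real x) - cis (2 * pi * t)) \<le> 2 * sin (pi * E)"
proof -
  define y where "y = of_int n * x - t - of_int k"
  have "exp (2 * of_real pi * \<i> * of_int n * of_real x) = cis (2 * pi * (of_int n * x))"
    by (simp add: cis_conv_exp mult_ac)
  also have "2 * pi * (of_int n * x) = 2 * (pi * y) + 2 * pi * t + 2 * pi * of_int k"
    unfolding y_def by (simp add: algebra_simps)
  also have "cis \<dots> = cis (2 * (pi * y)) * cis (2 * pi * t)"
    by (simp flip: cis_mult)
  finally have "exp (2 * of_real pi * \<i> * of_int n * of_real x) - cis (2 * pi * t)
      = (cis (2 * (pi * y)) - 1) * cis (2 * pi * t)"
    by (simp add: algebra_simps)
  then have "cmod (exp (2 * of_real pi * \<i> * of_int n * of_real x) - cis (2 * pi * t)) = 2 * \<bar>sin (pi * y)\<bar>"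
    by (simp only: norm_mult cmod_cis_minus_one norm_cis)
  moreover have "\<bar>sin (pi * y)\<bar> \<le> sin (pi * E)"
    using assms by (intro abs_sin_le) (auto simp: y_def abs_mult)
  ultimately show ?thesis by simp
qed

lemma angular_kronecker_constant_le:
  assumes approx: "\<And>t :: int \<Rightarrow> real. \<exists>x. \<forall>n\<in>S. \<exists>k :: int. \<bar>of_int n * x - t n - of_int k\<bar> \<le> E"
    and E: "0 \<le> E" "E \<le> 1/2"
  shows "angular_kronecker_constant S \<le> E"
proof -
  define \<alpha> where "\<alpha> = angular_kronecker_constant S"
  have \<alpha>: "0 \<le> \<alpha> \<and> \<alpha> \<le> 1/2 \<and>
     kronecker_constant S = cmod (exp (2 * of_real pi * \<i> * of_real \<alpha>) - 1)"
    unfolding \<alpha>_def angular_kronecker_constant_def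
    by (rule theI'[OF angular_kronecker_constant_ex1])
  have sin_nonneg: "0 \<le> sin (pi * E)"
    using E by (intro sin_ge_zero) (auto simp: mult_left_le)
  have "kronecker_constant S \<le> 2 * sin (pi * E)"
  \<comment> \<open>The definition asks for distances strictly below \<epsilon>, so
    \<open>2 * sin (pi * E)\<close> itself need not be admissible, but every larger \<epsilon>
    is.\<close>
  proof (rule dense_ge)
    fix \<epsilon> :: real assume \<epsilon>: "2 * sin (pi * E) < \<epsilon>"
    have "\<exists>x. \<forall>n\<in>S. cmod (exp (2 * of_real pi * \<i> * of_int n * of_real x) - f n) < \<epsilon>"
      if f: "\<forall>n\<in>S. cmod (f n) = 1" for f :: "int \<Rightarrow> complex"
    proof -
      define t where "t n = Arg (f n) / (2 * pi)" for n
      have t: "cis (2 * pi * t n) = f n" if "n \<in> S" for n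
        using f that rcis_cmod_Arg[of "f n"] by (simp add: t_def rcis_def)
      obtain x where "\<forall>n\<in>S. \<exists>k :: int. \<bar>of_int n * x - t n - of_int k\<bar> \<le> E"
        using approx by blast
      then have "cmod (exp (2 * of_real pi * \<i> * of_int n * of_real x) - f n) < \<epsilon>" if "n \<in> S" for n
        using cmod_exp_diff_le[of n x "t n" _ E] E t[OF that] that \<epsilon> by fastforce
      then show ?thesis by blast
    qed
    then show "kronecker_constant S \<le> \<epsilon>"
      unfolding kronecker_constant_def using \<epsilon> sin_nonneg
      by (intro cInf_lower) (auto intro!: bdd_belowI[of _ 0])
  qed
  then have "sin (pi * \<alpha>) \<le> sin (pi * E)"
    using \<alpha> cmod_exp_minus_one[of \<alpha>] by simp
  \<comment> \<open>Strict monotonicity of the sine up to \<open>pi / 2\<close> turns the comparison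
    of chords back into one of angles.\<close>
  moreover have "\<not> sin (pi * \<alpha>) \<le> sin (pi * E)" if "E < \<alpha>"
  proof -
    have "- (pi / 2) \<le> 0" "0 \<le> pi * E" using E by simp_all
    then have "- (pi / 2) \<le> pi * E" by (rule order_trans)
    moreover have "pi * E < pi * \<alpha>" "pi * \<alpha> \<le> pi / 2"
      using that \<alpha> by (simp_all add: field_simps)
    ultimately show ?thesis
      using sin_monotone_2pi[of "pi * E" "pi * \<alpha>"] by simp
  qed
  ultimately show ?thesis unfolding \<alpha>_def by force
qed

section \<open>Ordering by absolute value and the excluded sets\<close>

lemma card_3_sorted_abs:
  fixes S :: "int set"
  assumes "card S = 3"
  obtains p q r where "S = {p, q, r}" "p \<noteq> q" "q \<noteq> r" "p \<noteq> r" "\<bar>p\<bar> \<le> \<bar>q\<bar>" "\<bar>q\<bar> \<le> \<bar>r\<bar>"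
proof -
  obtain x y z where S: "S = {x, y, z}" "x \<noteq> y" "y \<noteq> z" "x \<noteq> z"
    using assms by (auto simp: card_3_iff)
  have perms: "S = {x, z, y}" "S = {y, x, z}" "S = {y, z, x}" "S = {z, x, y}" "S = {z, y, x}"
    using S(1) by auto
  consider "\<bar>x\<bar> \<le> \<bar>y\<bar> \<and> \<bar>y\<bar> \<le> \<bar>z\<bar>" | "\<bar>x\<bar> \<le> \<bar>z\<bar> \<and> \<bar>z\<bar> \<le> \<bar>y\<bar>"
    | "\<bar>y\<bar> \<le> \<bar>x\<bar> \<and> \<bar>x\<bar> \<le> \<bar>z\<bar>" | "\<bar>y\<bar> \<le> \<bar>z\<bar> \<and> \<bar>z\<bar> \<le> \<bar>x\<bar>"
    | "\<bar>z\<bar> \<le> \<bar>x\<bar> \<and> \<bar>x\<bar> \<le> \<bar>y\<bar>" | "\<bar>z\<bar> \<le> \<bar>y\<bar> \<and> \<bar>y\<bar> \<le> \<bar>x\<bar>"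
    by linarith
  then show ?thesis
    by cases (use that S perms in metis)+
qed

theorem theorem2:
  fixes S :: "int set"
  assumes "card S = 3"
    and "\<forall>n\<in>S. n \<noteq> 0"
    and "\<not> (\<exists>n. S = {-n, n, 2 * n})"
  shows "angular_kronecker_constant S \<le> 5 / 16"
proof -
  obtain p q r where S: "S = {p, q, r}" and distinct: "p \<noteq> q" "q \<noteq> r" "p \<noteq> r"
    and le: "\<bar>p\<bar> \<le> \<bar>q\<bar>" "\<bar>q\<bar> \<le> \<bar>r\<bar>"
    using card_3_sorted_abs[OF assms(1)] .
  have exc: "\<bar>r\<bar> \<noteq> \<bar>p\<bar> \<and> \<bar>r\<bar> \<noteq> 2 * \<bar>p\<bar>" if eq: "\<bar>p\<bar> = \<bar>q\<bar>"
  proof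
    \<comment> \<open>At most two integers share an absolute value.\<close>
    show "\<bar>r\<bar> \<noteq> \<bar>p\<bar>" using distinct eq by linarith
    show "\<bar>r\<bar> \<noteq> 2 * \<bar>p\<bar>"
    proof
      assume "\<bar>r\<bar> = 2 * \<bar>p\<bar>"
      moreover have "q = - p" using distinct eq by linarith
      \<comment> \<open>Either \<open>r = 2 * p\<close>, or
        \<open>r = - 2 * p = 2 * q\<close>.\<close>
      ultimately have "S = {- p, p, 2 * p} \<or> S = {- q, q, 2 * q}"
        unfolding S by (auto simp: abs_if split: if_splits)
      then show False using assms(3) by blast
    qed
  qed
  have "approximable (5/16) \<bar>p\<bar> \<bar>q\<bar> \<bar>r\<bar>"
    using assms(2) le exc unfolding S by (intro approximable_sorted) auto
  then have "approximable (5/16) p q r" by (rule approximable_abs)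
  then have "\<exists>x. \<forall>n\<in>S. \<exists>k :: int. \<bar>of_int n * x - t n - of_int k\<bar> \<le> 5/16" for t :: "int \<Rightarrow> real"
    unfolding approximable_def S ball_simps by blast
  then show ?thesis by (intro angular_kronecker_constant_le) simp_all
qed

end
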